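(* Let $P_1,P_2\subseteq\mathbb{R}^n$ be nonempty polytopes and let $$Q=\{(x^1,\lambda_1,x^2,\lambda_2)\in \operatorname{homog}(P_1)\times\operatorname{homog}(P_2) : \lambda_1+\lambda_2=1\}.$$ Then $Q$ is simple if and only if $P_1$ and $P_2$ are simplices.
   Context: For a polytope $P\subseteq\mathbb{R}^n$, its homogenization is $\operatorname{homog}(P):=\operatorname{cone}(P\times\{1\})\subseteq\mathbb{R}^{n+1}$, where $\operatorname{cone}(\cdot)$ denotes the conic hull; points of $\operatorname{homog}(P_i)$ are written as $(x^i,\lambda_i)$ with $x^i\in\mathbb{R}^n$, $\lambda_i\in\mathbb{R}$. The polytope $Q$ together with the projection $(x^1,\lambda_1,x^2,\lambda_2)\mapsto x^1+x^2$ is the disjunctive programming extension of $\operatorname{conv}(P_1\cup P_2)$. A $d$-dimensional polytope is called simple if every vertex of it is contained in exactly $d$ facets. A simplex is the convex hull of finitely many (at least one) affinely independent points. *)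

theory Defs
  imports "HOL-Analysis.Analysis"
begin

text \<open>
  The product space \<open>'a \<times> real\<close> plays the role of \<open>\<real>\<^sup>n\<^sup>+\<^sup>1\<close>. The conic hull is the set of all
  nonnegative linear combinations, i.e. the least \<^const>\<open>convex_cone\<close> (which always contains 0);
  the library's \<open>conic hull\<close> only closes under scaling of single points.
\<close>

definition homog :: "'a::euclidean_space set \<Rightarrow> ('a \<times> real) set" where
  "homog P = convex_cone hull (P \<times> {1})"

text \<open>A point \<open>(x\<^sup>1, \<lambda>\<^sub>1, x\<^sup>2, \<lambda>\<^sub>2)\<close> is represented by the nested pair \<open>((x1, l1), (x2, l2))\<close>.\<close>

definition disj_ext ::
    "'a::euclidean_space set \<Rightarrow> 'a set \<Rightarrow> (('a \<times> real) \<times> ('a \<times> real)) set" where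
  "disj_ext P1 P2 =
     {((x1, l1), (x2, l2)) | x1 l1 x2 l2.
        (x1, l1) \<in> homog P1 \<and> (x2, l2) \<in> homog P2 \<and> l1 + l2 = 1}"

text \<open>
  The dimension \<open>d\<close> is the affine dimension, so lower-dimensional polytopes are allowed. Vertices are
  extreme points. A polytope has finitely many faces, so \<^const>\<open>card\<close> counts facets correctly.
\<close>

definition simple_polytope :: "'a::euclidean_space set \<Rightarrow> bool" where
  "simple_polytope P \<longleftrightarrow> polytope P \<and>
     (\<forall>v. v extreme_point_of P \<longrightarrow> int (card {F. F facet_of P \<and> v \<in> F}) = aff_dim P)"

text \<open>The dimension is a natural number because \<open>-1 simplex {}\<close> holds in the library.\<close>

definition is_simplex :: "'a::euclidean_space set \<Rightarrow> bool" where
  "is_simplex P \<longleftrightarrow> (\<exists>d::nat. int d simplex P)"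

end

theory Submission
  imports Defs
begin

text \<open>
  Place \<open>P1\<close> and \<open>P2\<close> as \<open>lift1 ` P1\<close> and \<open>lift2 ` P2\<close> in skew affine subspaces. Then
  \<open>Q = disj_ext P1 P2\<close> is their join: it is the convex hull of the two copies, its dimension is
  \<open>aff_dim P1 + aff_dim P2 + 1\<close>, and the join of a nonempty face of \<open>P1\<close> with a nonempty face of
  \<open>P2\<close> is a face of \<open>Q\<close>. In particular each vertex of \<open>P1\<close> is joined to each vertex of \<open>P2\<close> by
  an edge of \<open>Q\<close>. This abundance of edges is what simplicity cannot tolerate.

  Indeed, in a simple polytope a vertex \<open>v\<close> has at most \<open>aff_dim T\<close> neighbours on any face \<open>T\<close>
  through it (\<open>simple_polytope_card_neighbours_le\<close>). Take for \<open>T\<close> the pyramid with apex a vertex of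
  \<open>P1\<close> and base \<open>P2\<close>, a face of dimension \<open>aff_dim P2 + 1\<close>. All vertices of \<open>P2\<close> are neighbours
  of the apex, so there are at most \<open>aff_dim P2 + 1\<close> of them; a polytope with so few vertices is a
  simplex. The same argument with the roles exchanged applies to \<open>P1\<close>.

  Conversely, the two copies of affinely independent sets have an affinely independent union, so the
  join of two simplices is a simplex, and a \<open>d\<close>-simplex is simple: its facets through a
  vertex are those opposite to the \<open>d\<close> other vertices.
\<close>

section \<open>Counting the facets around a face\<close>

text \<open>
  Intersecting with \<open>Q\<close> covers the face \<open>Q\<close> itself, which lies in no facet. A nonempty face is
  thus determined by the facets containing it, which is how faces are told apart below.
\<close>
lemma polyhedron_face_eq_Int_facets:
  fixes Q :: "'a::euclidean_space set"
  assumes "polyhedron Q" "C face_of Q" "C \<noteq> {}"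
  shows "C = Q \<inter> \<Inter>{F. F facet_of Q \<and> C \<subseteq> F}"
proof (cases "C = Q")
  case True
  then show ?thesis by auto
next
  case False
  have "C = \<Inter>{F. F facet_of Q \<and> C \<subseteq> F}"
    using face_of_polyhedron[OF assms False] .
  moreover have "C \<subseteq> Q"
    using assms(2) face_of_imp_subset by blast
  ultimately show ?thesis by blast
qed

text \<open>
  Descend from \<open>D\<close> to \<open>C\<close> through a chain of faces, each a facet of the one before. Every step
  lowers the dimension by one and strictly enlarges the set of facets of \<open>Q\<close> containing the face,
  since that set determines the face.
\<close>
lemma facets_containing_nested_faces:
  fixes Q :: "'a::euclidean_space set"
  assumes Q: "polyhedron Q" and "D face_of Q" and "C face_of D" and "C \<noteq> {}"
  shows "int (card {F. F facet_of Q \<and> D \<subseteq> F}) + (aff_dim D - aff_dim C)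
           \<le> int (card {F. F facet_of Q \<and> C \<subseteq> F})"
  using assms(2-)
proof (induction "nat (aff_dim D - aff_dim C)" arbitrary: D rule: less_induct)
  case less
  show ?case
  proof (cases "C = D")
    case False
    have polyD: "polyhedron D"
      using Q less.prems(1) face_of_polyhedron_polyhedron by blast
    obtain D' where D': "D' facet_of D" "C \<subseteq> D'"
      using face_of_polyhedron_subset_facet[OF polyD less.prems(2,3) False] .
    then have dim: "aff_dim D' = aff_dim D - 1" and D'D: "D' face_of D" and ne: "D' \<noteq> {}"
      by (auto simp: facet_of_def)
    have D'Q: "D' face_of Q"
      using D'D less.prems(1) face_of_trans by blast
    have CD': "C face_of D'"
      using D' D'D less.prems(2) face_of_subset face_of_imp_subset by blast
    have "aff_dim C \<le> aff_dim D'"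
      using D'(2) aff_dim_subset by blast
    then have IH: "int (card {F. F facet_of Q \<and> D' \<subseteq> F}) + (aff_dim D' - aff_dim C)
           \<le> int (card {F. F facet_of Q \<and> C \<subseteq> F})"
      using less.hyps[of D'] dim D'Q CD' less.prems(3) by simp
    have sub: "D' \<subseteq> D" "D' \<noteq> D"
      using D'D dim face_of_imp_subset by auto
    have "{F. F facet_of Q \<and> D \<subseteq> F} \<noteq> {F. F facet_of Q \<and> D' \<subseteq> F}"
      using polyhedron_face_eq_Int_facets[OF Q D'Q ne]
        polyhedron_face_eq_Int_facets[OF Q less.prems(1)] sub ne by fastforce
    then have "{F. F facet_of Q \<and> D \<subseteq> F} \<subset> {F. F facet_of Q \<and> D' \<subseteq> F}"
      using sub by blast
    moreover have "finite {F. F facet_of Q \<and> D' \<subseteq> F}"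
      using finite_polyhedron_facets[OF Q] by (rule rev_finite_subset) auto
    ultimately have "card {F. F facet_of Q \<and> D \<subseteq> F} < card {F. F facet_of Q \<and> D' \<subseteq> F}"
      by (rule psubset_card_mono[rotated])
    with IH dim show ?thesis by simp
  qed simp
qed

lemma codim_le_card_facets_containing:
  fixes Q :: "'a::euclidean_space set"
  assumes "polyhedron Q" "C face_of Q" "C \<noteq> {}"
  shows "aff_dim Q - aff_dim C \<le> int (card {F. F facet_of Q \<and> C \<subseteq> F})"
  using facets_containing_nested_faces[OF assms(1) face_of_refl assms(2,3)]
    polyhedron_imp_convex[OF assms(1)] by simp

text \<open>
  Let \<open>d\<close> be the dimension of \<open>Q\<close>. Of the \<open>d\<close> facets through \<open>v\<close>, at least \<open>d - 1\<close>
  contain a given edge at \<open>v\<close>, hence exactly one facet through \<open>v\<close> misses the other end \<open>w\<close>.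
  This facet determines the edge, so distinct neighbours \<open>w\<close> miss distinct facets. None of
  these contains \<open>T\<close>, while at least \<open>d - aff_dim T\<close> facets do, which leaves at most
  \<open>aff_dim T\<close> facets for the neighbours in \<open>T\<close>.
\<close>
lemma simple_polytope_card_neighbours_le:
  fixes Q :: "'a::euclidean_space set"
  assumes simple: "simple_polytope Q"
    and v: "v extreme_point_of Q"
    and T: "T face_of Q" "v \<in> T"
    and W: "W \<subseteq> T" "v \<notin> W"
    and edge: "\<And>w. w \<in> W \<Longrightarrow> closed_segment v w face_of Q"
  shows "int (card W) \<le> aff_dim T"
proof -
  define \<F> where "\<F> C = {F. F facet_of Q \<and> C \<subseteq> F}" for C
  have polyh: "polyhedron Q"
    using simple polytope_imp_polyhedron by (auto simp: simple_polytope_def)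
  have fin: "finite (\<F> C)" for C
    unfolding \<F>_def using finite_polyhedron_facets[OF polyh] by (rule rev_finite_subset) auto
  have cardv: "int (card (\<F> {v})) = aff_dim Q"
    using simple v by (simp add: simple_polytope_def \<F>_def)
  have vface: "{v} face_of Q"
    using v by (simp add: face_of_singleton)
  have card_edge: "aff_dim Q - 1 \<le> int (card (\<F> (closed_segment v w)))" if "w \<in> W" for w
  proof -
    have "v \<noteq> w" using W that by blast
    then have "aff_dim (closed_segment v w) = 1"
      by (simp add: segment_convex_hull aff_dim_convex_hull aff_dim_2)
    then show ?thesis
      using codim_le_card_facets_containing[OF polyh edge[OF that]] by (simp add: \<F>_def)
  qed
  have "\<exists>F \<in> \<F> {v}. w \<notin> F" if "w \<in> W" for w
  proof (rule ccontr)
    assume "\<not> ?thesis"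
    moreover have "w \<in> Q"
      using that W(1) T(1) face_of_imp_subset by blast
    ultimately have "w \<in> Q \<inter> \<Inter>(\<F> {v})" by blast
    then have "w \<in> {v}"
      using polyhedron_face_eq_Int_facets[OF polyh vface] by (auto simp: \<F>_def)
    then show False using W that by blast
  qed
  then obtain g where g: "\<And>w. w \<in> W \<Longrightarrow> g w \<in> \<F> {v}" "\<And>w. w \<in> W \<Longrightarrow> w \<notin> g w"
    by metis
  \<comment> \<open>\<open>g w\<close> is a facet through \<open>v\<close> but not \<open>w\<close>; the count leaves room for only one.\<close>
  have edge_facets: "\<F> (closed_segment v w) = \<F> {v} - {g w}" if w: "w \<in> W" for w
  proof (rule card_subset_eq)
    show "\<F> (closed_segment v w) \<subseteq> \<F> {v} - {g w}"
      using g(2)[OF w] by (auto simp: \<F>_def)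
    then have "card (\<F> (closed_segment v w)) \<le> card (\<F> {v} - {g w})"
      using fin by (intro card_mono) auto
    moreover have "card (\<F> {v} - {g w}) = card (\<F> {v}) - 1" "card (\<F> {v}) > 0"
      using g(1)[OF w] fin by (auto simp: card_gt_0_iff)
    ultimately show "card (\<F> (closed_segment v w)) = card (\<F> {v} - {g w})"
      using card_edge[OF w] cardv by linarith
  qed (use fin in auto)
  have "inj_on g W"
  proof (rule inj_onI)
    fix w w' assume w: "w \<in> W" "w' \<in> W" "g w = g w'"
    then have "\<F> (closed_segment v w) = \<F> (closed_segment v w')"
      using edge_facets by simp
    then have "closed_segment v w = closed_segment v w'"
      using polyhedron_face_eq_Int_facets[OF polyh edge[OF w(1)]]
        polyhedron_face_eq_Int_facets[OF polyh edge[OF w(2)]] by (simp add: \<F>_def)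
    then show "w = w'"
      by (auto simp: closed_segment_eq doubleton_eq_iff)
  qed
  then have "card W = card (g ` W)"
    by (simp add: card_image)
  moreover have "card (g ` W \<union> \<F> T) = card (g ` W) + card (\<F> T)"
  proof (rule card_Un_disjoint)
    show "finite (g ` W)"
      using g(1) fin by (meson finite_subset image_subsetI)
    show "g ` W \<inter> \<F> T = {}"
      using g(2) W(1) by (auto simp: \<F>_def)
  qed (rule fin)
  moreover have "card (g ` W \<union> \<F> T) \<le> card (\<F> {v})"
    using g(1) T(2) by (intro card_mono[OF fin]) (auto simp: \<F>_def)
  moreover have "aff_dim Q - aff_dim T \<le> int (card (\<F> T))"
    using codim_le_card_facets_containing[OF polyh T(1)] T(2) by (auto simp: \<F>_def)
  ultimately show ?thesis
    using cardv by linarith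
qed

section \<open>Simplices\<close>

text \<open>
  The vertices span a space of the dimension of \<open>P\<close>, which takes at least \<open>aff_dim P + 1\<close>
  points; equality makes them affinely independent.
\<close>
lemma is_simplex_if_few_vertices:
  fixes P :: "'a::euclidean_space set"
  assumes "polytope P" "P \<noteq> {}"
    and card: "int (card {v. v extreme_point_of P}) \<le> aff_dim P + 1"
  shows "is_simplex P"
proof -
  let ?V = "{v. v extreme_point_of P}"
  have fin: "finite ?V"
    using assms(1) finite_polyhedron_extreme_points polytope_imp_polyhedron by blast
  have P: "P = convex hull ?V"
    using assms(1) Krein_Milman_polytope by (auto simp: polytope_def)
  then have dim: "aff_dim ?V = aff_dim P"
    by (metis aff_dim_convex_hull)
  have "aff_dim ?V = int (card ?V) - 1"
    using aff_dim_le_card[OF fin] card dim by linarith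
  then have "\<not> affine_dependent ?V" "int (card ?V) = aff_dim P + 1"
    using fin affine_independent_iff_card dim by auto
  moreover have "aff_dim P = int (nat (aff_dim P))"
    using assms(2) aff_dim_negative_iff[of P] by linarith
  ultimately show ?thesis
    unfolding is_simplex_def simplex_def using P by metis
qed

text \<open>The facets through the vertex \<open>v\<close> are the ones opposite to the other points of \<open>S\<close>.\<close>
lemma simple_polytope_convex_hull_affine_independent:
  fixes S :: "'a::euclidean_space set"
  assumes "\<not> affine_dependent S"
  shows "simple_polytope (convex hull S)"
proof -
  have fin: "finite S"
    using assms aff_independent_finite by blast
  have notin: "u \<notin> convex hull (S - {u})" if "u \<in> S" for u
    using assms that convex_hull_subset_affine_hull by (fastforce simp: affine_dependent_def)
  have "int (card {F. F facet_of convex hull S \<and> v \<in> F}) = aff_dim (convex hull S)"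
    if "v extreme_point_of convex hull S" for v
  proof -
    have v: "v \<in> S"
      using that assms extreme_point_of_convex_hull_affine_independent by blast
    have eq: "{F. F facet_of convex hull S \<and> v \<in> F} = (\<lambda>u. convex hull (S - {u})) ` (S - {v})"
      using v notin by (auto simp: facet_of_convex_hull_affine_independent[OF assms] hull_inc)
    have "inj_on (\<lambda>u. convex hull (S - {u})) (S - {v})"
    proof (rule inj_onI)
      fix u w assume *: "u \<in> S - {v}" "w \<in> S - {v}"
        "convex hull (S - {u}) = convex hull (S - {w})"
      show "u = w"
      proof (rule ccontr)
        assume "u \<noteq> w"
        then have "u \<in> convex hull (S - {w})"
          using * by (auto intro: hull_inc)
        then show False using * notin by auto
      qed
    qed
    then have "card {F. F facet_of convex hull S \<and> v \<in> F} = card S - 1"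
      unfolding eq using v fin by (simp add: card_image)
    moreover have "card S > 0" using v fin card_gt_0_iff by blast
    ultimately show ?thesis
      using assms by (simp add: aff_dim_convex_hull aff_dim_affine_independent)
  qed
  then show ?thesis
    unfolding simple_polytope_def using fin by (auto simp: polytope_def)
qed

section \<open>The extension as a join\<close>

definition lift1 :: "'a::euclidean_space \<Rightarrow> ('a \<times> real) \<times> ('a \<times> real)" where
  "lift1 x = ((x, 1), 0)"

definition lift2 :: "'a::euclidean_space \<Rightarrow> ('a \<times> real) \<times> ('a \<times> real)" where
  "lift2 x = (0, (x, 1))"

lemma inj_lift1: "inj lift1" and inj_lift2: "inj lift2" and lift1_neq_lift2: "lift1 x \<noteq> lift2 y"
  by (auto simp: inj_def lift1_def lift2_def zero_prod_def)

text \<open>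
  The embeddings are affine, not linear; splitting off the translation reduces the hulls of
  the copies to facts on linear images.
\<close>
lemma lift1_translation_linear: "lift1 = (+) ((0, 1), 0) \<circ> (\<lambda>x. ((x, 0), 0))"
  and lift2_translation_linear: "lift2 = (+) (0, (0, 1)) \<circ> (\<lambda>x. (0, (x, 0)))"
  by (auto simp: lift1_def lift2_def fun_eq_iff)

lemma linear_pair_embeddings:
  "linear (\<lambda>x::'a::euclidean_space. ((x, 0::real), 0::'a \<times> real))"
  "linear (\<lambda>x::'a::euclidean_space. (0::'a \<times> real, (x, 0::real)))"
  by (auto intro!: linearI simp: zero_prod_def)

lemma convex_hull_lift:
  "convex hull (lift1 ` A) = lift1 ` (convex hull A)"
  "convex hull (lift2 ` A) = lift2 ` (convex hull A)"
  unfolding lift1_translation_linear lift2_translation_linear image_comp[symmetric]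
  by (simp_all add: convex_hull_translation convex_hull_linear_image linear_pair_embeddings)

lemma affine_hull_lift:
  "affine hull (lift1 ` A) = lift1 ` (affine hull A)"
  "affine hull (lift2 ` A) = lift2 ` (affine hull A)"
  unfolding lift1_translation_linear lift2_translation_linear image_comp[symmetric]
  by (simp_all add: affine_hull_translation affine_hull_linear_image linear_pair_embeddings
      linear_linear)

text \<open>
  Convexity of \<open>P\<close> makes it enough to scale single points, and then \<open>l\<close> is the scaling factor.
\<close>
lemma mem_homog_iff:
  assumes "convex P" "P \<noteq> {}"
  shows "(x, l) \<in> homog P \<longleftrightarrow> 0 \<le> l \<and> (\<exists>p\<in>P. x = l *\<^sub>R p)"
proof -
  have "convex hull (P \<times> {1::real}) = P \<times> {1}"
    using assms by (simp add: convex_Times hull_same)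
  then show ?thesis
    using assms unfolding homog_def by (auto simp: convex_cone_hull_convex_hull_nonempty)
qed

lemma convex_disj_ext: "convex (disj_ext P1 P2)"
proof -
  \<comment> \<open>The condition \<open>l1 + l2 = 1\<close> is a hyperplane.\<close>
  have "disj_ext P1 P2 = (homog P1 \<times> homog P2) \<inter> {z. ((0, 1), (0, 1)) \<bullet> z = 1}"
    by (auto simp: disj_ext_def)
  then show ?thesis
    by (simp add: convex_Int convex_Times convex_hyperplane homog_def convex_convex_cone_hull)
qed

lemma lift1_mem_disj_ext:
  assumes "convex P1" "convex P2" "P2 \<noteq> {}" "x \<in> P1"
  shows "lift1 x \<in> disj_ext P1 P2"
proof -
  have "P1 \<noteq> {}"
    using assms(4) by blast
  then have "(x, 1) \<in> homog P1" "(0, 0) \<in> homog P2"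
    using assms by (auto simp: mem_homog_iff)
  then show ?thesis
    by (simp add: disj_ext_def lift1_def zero_prod_def)
qed

lemma lift2_mem_disj_ext:
  assumes "convex P1" "convex P2" "P1 \<noteq> {}" "x \<in> P2"
  shows "lift2 x \<in> disj_ext P1 P2"
proof -
  have "P2 \<noteq> {}"
    using assms(4) by blast
  then have "(0, 0) \<in> homog P1" "(x, 1) \<in> homog P2"
    using assms by (auto simp: mem_homog_iff)
  then show ?thesis
    by (simp add: disj_ext_def lift2_def zero_prod_def)
qed

text \<open>
  A point of the extension is \<open>((l1 *\<^sub>R p1, l1), (l2 *\<^sub>R p2, l2))\<close> with \<open>l1 + l2 = 1\<close>, which is the
  convex combination of \<open>lift1 p1\<close> and \<open>lift2 p2\<close> with weights \<open>l1\<close> and \<open>l2\<close>.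
\<close>
lemma disj_ext_convex_hull:
  assumes "A \<noteq> {}" "B \<noteq> {}"
  shows "disj_ext (convex hull A) (convex hull B) = convex hull (lift1 ` A \<union> lift2 ` B)"
    (is "?L = ?R")
proof
  note mem = mem_homog_iff[OF convex_convex_hull]
  show "?R \<subseteq> ?L"
  proof (rule hull_minimal)
    show "lift1 ` A \<union> lift2 ` B \<subseteq> ?L"
      using assms
      by (intro Un_least image_subsetI lift1_mem_disj_ext lift2_mem_disj_ext) (auto intro: hull_inc)
  qed (rule convex_disj_ext)
  show "?L \<subseteq> ?R"
  proof
    fix z assume "z \<in> ?L"
    then obtain l1 p1 l2 p2 where z: "z = ((l1 *\<^sub>R p1, l1), (l2 *\<^sub>R p2, l2))" "0 \<le> l1" "0 \<le> l2"
      "l1 + l2 = 1" and p: "p1 \<in> convex hull A" "p2 \<in> convex hull B"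
      using assms by (auto simp: disj_ext_def mem)
    have "lift1 p1 \<in> ?R" "lift2 p2 \<in> ?R"
      using p convex_hull_lift[of A] convex_hull_lift[of B]
        hull_mono[of "lift1 ` A" "lift1 ` A \<union> lift2 ` B" convex]
        hull_mono[of "lift2 ` B" "lift1 ` A \<union> lift2 ` B" convex] by auto
    then have "l1 *\<^sub>R lift1 p1 + l2 *\<^sub>R lift2 p2 \<in> ?R"
      using z by (intro convexD) auto
    then show "z \<in> ?R"
      using z(1) by (simp add: lift1_def lift2_def)
  qed
qed

lemma affine_independent_coefficients_zero:
  fixes A :: "'a::euclidean_space set"
  assumes "\<not> affine_dependent A" "(\<Sum>a\<in>A. u a) = 0" "(\<Sum>a\<in>A. u a *\<^sub>R a) = 0" "a \<in> A"
  shows "u a = 0"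
proof -
  have "finite A"
    using assms(1) by (rule aff_independent_finite)
  from assms show ?thesis
    unfolding affine_dependent_explicit_finite[OF \<open>finite A\<close>] by blast
qed

text \<open>
  A vanishing combination of the lifted points splits into its two blocks. In each block the last
  coordinate says that the coefficients sum to zero, so each block is an affine relation on its own.
\<close>
lemma affine_independent_lifts:
  assumes "\<not> affine_dependent A" "\<not> affine_dependent B"
  shows "\<not> affine_dependent (lift1 ` A \<union> lift2 ` B)"
proof
  have fin: "finite A" "finite B"
    using assms aff_independent_finite by auto
  assume "affine_dependent (lift1 ` A \<union> lift2 ` B)"
  then obtain u where u: "\<exists>z \<in> lift1 ` A \<union> lift2 ` B. u z \<noteq> 0"
    and "(\<Sum>z \<in> lift1 ` A \<union> lift2 ` B. u z *\<^sub>R z) = 0"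
    using fin by (auto simp: affine_dependent_explicit_finite)
  moreover have "(\<Sum>z \<in> lift1 ` A \<union> lift2 ` B. u z *\<^sub>R z) =
      (\<Sum>a\<in>A. u (lift1 a) *\<^sub>R lift1 a) + (\<Sum>b\<in>B. u (lift2 b) *\<^sub>R lift2 b)"
  proof -
    have "inj_on lift1 A" "inj_on lift2 B"
      using inj_lift1 inj_lift2 inj_on_subset by blast+
    moreover have "lift1 ` A \<inter> lift2 ` B = {}"
      using lift1_neq_lift2 by (metis disjoint_iff imageE)
    ultimately show ?thesis
      using fin by (simp add: sum.union_disjoint sum.reindex)
  qed
  moreover have "(\<Sum>a\<in>A. u (lift1 a) *\<^sub>R lift1 a) =
      ((\<Sum>a\<in>A. u (lift1 a) *\<^sub>R a, \<Sum>a\<in>A. u (lift1 a)), 0)"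
    by (simp add: lift1_def prod_eq_iff fst_sum snd_sum)
  moreover have "(\<Sum>b\<in>B. u (lift2 b) *\<^sub>R lift2 b) =
      (0, (\<Sum>b\<in>B. u (lift2 b) *\<^sub>R b, \<Sum>b\<in>B. u (lift2 b)))"
    by (simp add: lift2_def prod_eq_iff fst_sum snd_sum)
  ultimately have "(\<Sum>a\<in>A. u (lift1 a) *\<^sub>R a) = 0" "(\<Sum>a\<in>A. u (lift1 a)) = 0"
    and B0: "(\<Sum>b\<in>B. u (lift2 b) *\<^sub>R b) = 0" "(\<Sum>b\<in>B. u (lift2 b)) = 0"
    by (auto simp: zero_prod_def)
  then have "u (lift1 a) = 0" if "a \<in> A" for a
    using affine_independent_coefficients_zero[OF assms(1), of "\<lambda>a. u (lift1 a)"] that by blast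
  moreover have "u (lift2 b) = 0" if "b \<in> B" for b
    using affine_independent_coefficients_zero[OF assms(2), of "\<lambda>b. u (lift2 b)"] B0 that by blast
  ultimately show False
    using u by blast
qed

text \<open>Affine bases of the two factors combine to an affine basis of the join.\<close>
lemma aff_dim_disj_ext:
  assumes "convex P1" "P1 \<noteq> {}" "convex P2" "P2 \<noteq> {}"
  shows "aff_dim (disj_ext P1 P2) = aff_dim P1 + aff_dim P2 + 1"
proof -
  obtain A where A: "\<not> affine_dependent A" "affine hull P1 = affine hull A"
    using affine_basis_exists by blast
  obtain B where B: "\<not> affine_dependent B" "affine hull P2 = affine hull B"
    using affine_basis_exists by blast
  let ?J = "lift1 ` A \<union> lift2 ` B"
  have "affine hull (lift1 ` P1 \<union> lift2 ` P2)
      = affine hull (affine hull (lift1 ` P1) \<union> affine hull (lift2 ` P2))"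
    by (metis hull_Un_left hull_Un_right)
  also have "\<dots> = affine hull (affine hull (lift1 ` A) \<union> affine hull (lift2 ` B))"
    by (simp add: affine_hull_lift A B)
  also have "\<dots> = affine hull ?J"
    by (metis hull_Un_left hull_Un_right)
  finally have hull: "affine hull (lift1 ` P1 \<union> lift2 ` P2) = affine hull ?J" .
  have "disj_ext P1 P2 = convex hull (lift1 ` P1 \<union> lift2 ` P2)"
    using disj_ext_convex_hull[OF assms(2,4)] assms by (simp add: hull_same)
  then have "aff_dim (disj_ext P1 P2) = aff_dim (affine hull (lift1 ` P1 \<union> lift2 ` P2))"
    by (simp add: aff_dim_convex_hull)
  also have "\<dots> = aff_dim ?J"
    unfolding hull by simp
  also have "\<dots> = int (card ?J) - 1"
    using affine_independent_lifts[OF A(1) B(1)] by (simp add: affine_independent_iff_card)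
  also have "card ?J = card A + card B"
  proof -
    have "inj_on lift1 A" "inj_on lift2 B"
      using inj_lift1 inj_lift2 inj_on_subset by blast+
    moreover have "lift1 ` A \<inter> lift2 ` B = {}"
      using lift1_neq_lift2 by (metis disjoint_iff imageE)
    ultimately show ?thesis
      using A B by (simp add: card_Un_disjoint card_image aff_independent_finite)
  qed
  finally have "aff_dim (disj_ext P1 P2) = int (card A + card B) - 1" .
  moreover have "aff_dim P1 = int (card A) - 1" "aff_dim P2 = int (card B) - 1"
    using A B aff_dim_affine_hull[of P1] aff_dim_affine_hull[of P2]
    by (simp_all add: affine_independent_iff_card)
  ultimately show ?thesis by simp
qed

text \<open>
  An inequality \<open>a \<bullet> x \<le> b\<close> supporting \<open>P\<close> along \<open>F\<close> homogenizes to one that supports the cone over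
  \<open>P\<close> along the cone over \<open>F\<close>. Nonemptiness of \<open>F\<close> lets \<open>mem_homog_iff\<close> describe the cone over
  \<open>F\<close>.
\<close>
lemma homog_supporting_functional:
  assumes P: "convex P" "P \<noteq> {}" and le: "P \<subseteq> {x. a \<bullet> x \<le> b}"
    and F: "F = P \<inter> {x. a \<bullet> x = b}" "F \<noteq> {}"
    and mem: "(x, l) \<in> homog P"
  shows "a \<bullet> x - b * l \<le> 0" and "(x, l) \<in> homog F \<longleftrightarrow> a \<bullet> x - b * l = 0"
proof -
  have "convex F"
    using F(1) P(1) by (simp add: convex_Int convex_hyperplane)
  note memF = mem_homog_iff[OF this F(2)]
  obtain p where p: "p \<in> P" "0 \<le> l" "x = l *\<^sub>R p"
    using mem mem_homog_iff[OF P] by auto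
  then have val: "a \<bullet> x - b * l = l * (a \<bullet> p - b)"
    by (simp add: algebra_simps)
  show "a \<bullet> x - b * l \<le> 0"
    unfolding val using p(1,2) le by (intro mult_nonneg_nonpos) auto
  show "(x, l) \<in> homog F \<longleftrightarrow> a \<bullet> x - b * l = 0"
  proof
    assume "(x, l) \<in> homog F"
    then show "a \<bullet> x - b * l = 0"
      using memF F(1) by auto
  next
    assume "a \<bullet> x - b * l = 0"
    then have "l = 0 \<or> p \<in> F"
      using val p F(1) by auto
    then show "(x, l) \<in> homog F"
      unfolding memF using p F(2) by auto
  qed
qed

text \<open>
  Faces of polytopes are exposed. After homogenization the two supporting inequalities have right-hand
  side zero, so their sum is again valid and is tight exactly where both are; it therefore
  exposes the join of the two faces.
\<close>
lemma disj_ext_face_of: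
  fixes P1 P2 :: "'a::euclidean_space set"
  assumes P: "polytope P1" "polytope P2"
    and F: "F1 face_of P1" "F1 \<noteq> {}" "F2 face_of P2" "F2 \<noteq> {}"
  shows "disj_ext F1 F2 face_of disj_ext P1 P2"
proof -
  have ne: "P1 \<noteq> {}" "P2 \<noteq> {}"
    using F face_of_imp_subset by blast+
  have cv: "convex P1" "convex P2"
    using P polytope_imp_convex by auto
  have "F1 exposed_face_of P1" "F2 exposed_face_of P2"
    using F P polytope_imp_polyhedron exposed_face_of_polyhedron by blast+
  then obtain a1 b1 a2 b2 where
    1: "P1 \<subseteq> {x. a1 \<bullet> x \<le> b1}" "F1 = P1 \<inter> {x. a1 \<bullet> x = b1}" and
    2: "P2 \<subseteq> {x. a2 \<bullet> x \<le> b2}" "F2 = P2 \<inter> {x. a2 \<bullet> x = b2}"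
    unfolding exposed_face_of_def by blast
  note h1 = homog_supporting_functional[OF cv(1) ne(1) 1 F(2)]
  note h2 = homog_supporting_functional[OF cv(2) ne(2) 2 F(4)]
  let ?c = "((a1, - b1), (a2, - b2))"
  have sub: "homog F1 \<subseteq> homog P1" "homog F2 \<subseteq> homog P2"
    unfolding homog_def using F face_of_imp_subset by (auto intro!: hull_mono)
  have le: "?c \<bullet> z \<le> 0" and eq: "z \<in> disj_ext F1 F2 \<longleftrightarrow> ?c \<bullet> z = 0"
    if zQ: "z \<in> disj_ext P1 P2" for z
  proof -
    obtain x1 l1 x2 l2 where z: "z = ((x1, l1), (x2, l2))"
      and m: "(x1, l1) \<in> homog P1" "(x2, l2) \<in> homog P2" "l1 + l2 = 1"
      using zQ by (auto simp: disj_ext_def)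
    have val: "?c \<bullet> z = (a1 \<bullet> x1 - b1 * l1) + (a2 \<bullet> x2 - b2 * l2)"
      by (simp add: z)
    show "?c \<bullet> z \<le> 0"
      using val h1(1)[OF m(1)] h2(1)[OF m(2)] by linarith
    have "z \<in> disj_ext F1 F2 \<longleftrightarrow> (x1, l1) \<in> homog F1 \<and> (x2, l2) \<in> homog F2"
      using m by (simp add: z disj_ext_def)
    also have "\<dots> \<longleftrightarrow> ?c \<bullet> z = 0"
      using val h1[OF m(1)] h2[OF m(2)] by linarith
    finally show "z \<in> disj_ext F1 F2 \<longleftrightarrow> ?c \<bullet> z = 0" .
  qed
  have "disj_ext F1 F2 \<subseteq> disj_ext P1 P2"
    using sub by (auto simp: disj_ext_def)
  then have "disj_ext F1 F2 = disj_ext P1 P2 \<inter> {z. ?c \<bullet> z = 0}"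
    using eq by blast
  then show ?thesis
    using face_of_Int_supporting_hyperplane_le[OF convex_disj_ext, of P1 P2 ?c 0] le by simp
qed

lemma segment_lifts_face_of_disj_ext:
  assumes "polytope P1" "polytope P2" "v1 extreme_point_of P1" "v2 extreme_point_of P2"
  shows "closed_segment (lift1 v1) (lift2 v2) face_of disj_ext P1 P2"
proof -
  have "disj_ext {v1} {v2} = closed_segment (lift1 v1) (lift2 v2)"
    using disj_ext_convex_hull[of "{v1}" "{v2}"]
    by (simp add: segment_convex_hull insert_commute)
  then show ?thesis
    using disj_ext_face_of[OF assms(1,2), of "{v1}" "{v2}"] assms(3,4)
    by (simp add: face_of_singleton)
qed

section \<open>The characterization\<close>

theorem theorem2p5:
  fixes P1 P2 :: "(real ^ 'n) set"
  assumes "polytope P1" and "P1 \<noteq> {}"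
    and "polytope P2" and "P2 \<noteq> {}"
  shows "simple_polytope (disj_ext P1 P2) \<longleftrightarrow> is_simplex P1 \<and> is_simplex P2"
proof
  assume simple: "simple_polytope (disj_ext P1 P2)"
  let ?V1 = "{v. v extreme_point_of P1}" and ?V2 = "{v. v extreme_point_of P2}"
  have cv: "convex P1" "convex P2"
    using assms polytope_imp_convex by auto
  have "?V1 \<noteq> {}" "?V2 \<noteq> {}"
    using assms extreme_point_exists_convex polytope_imp_compact cv by blast+
  then obtain v1 v2 where v: "v1 extreme_point_of P1" "v2 extreme_point_of P2"
    by blast
  note seg = segment_lifts_face_of_disj_ext[OF assms(1,3)]
  have ends: "lift1 v1 extreme_point_of disj_ext P1 P2" "lift2 v2 extreme_point_of disj_ext P1 P2"
    using seg[OF v] extreme_point_of_segment face_of_singleton face_of_trans by metis+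
  have faces: "disj_ext {v1} P2 face_of disj_ext P1 P2" "disj_ext P1 {v2} face_of disj_ext P1 P2"
    using assms v cv by (auto intro!: disj_ext_face_of simp: face_of_singleton face_of_refl)
  \<comment> \<open>Count the neighbours of an apex on the pyramid over the other polytope.\<close>
  have "int (card (lift2 ` ?V2)) \<le> aff_dim (disj_ext {v1} P2)"
  proof (rule simple_polytope_card_neighbours_le[OF simple ends(1) faces(1)])
    show "lift1 v1 \<in> disj_ext {v1} P2"
      using assms cv by (simp add: lift1_mem_disj_ext)
    show "lift2 ` ?V2 \<subseteq> disj_ext {v1} P2"
      using cv by (intro image_subsetI lift2_mem_disj_ext) (auto simp: extreme_point_of_def)
    show "lift1 v1 \<notin> lift2 ` ?V2"
      using lift1_neq_lift2 by fast
    show "closed_segment (lift1 v1) w face_of disj_ext P1 P2" if "w \<in> lift2 ` ?V2" for w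
      using that seg[OF v(1)] by fast
  qed
  moreover have "int (card (lift1 ` ?V1)) \<le> aff_dim (disj_ext P1 {v2})"
  proof (rule simple_polytope_card_neighbours_le[OF simple ends(2) faces(2)])
    show "lift2 v2 \<in> disj_ext P1 {v2}"
      using assms cv by (simp add: lift2_mem_disj_ext)
    show "lift1 ` ?V1 \<subseteq> disj_ext P1 {v2}"
      using cv by (intro image_subsetI lift1_mem_disj_ext) (auto simp: extreme_point_of_def)
    show "lift2 v2 \<notin> lift1 ` ?V1"
      using lift1_neq_lift2 by (metis imageE)
    show "closed_segment (lift2 v2) w face_of disj_ext P1 P2" if "w \<in> lift1 ` ?V1" for w
      using that seg[OF _ v(2)] by (metis closed_segment_commute imageE mem_Collect_eq)
  qed
  moreover have "card (lift1 ` ?V1) = card ?V1" "card (lift2 ` ?V2) = card ?V2"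
    using inj_lift1 inj_lift2 inj_on_subset by (blast intro: card_image)+
  ultimately have "int (card ?V1) \<le> aff_dim P1 + 1" "int (card ?V2) \<le> aff_dim P2 + 1"
    using assms cv by (simp_all add: aff_dim_disj_ext)
  then show "is_simplex P1 \<and> is_simplex P2"
    using assms is_simplex_if_few_vertices by blast
next
  assume "is_simplex P1 \<and> is_simplex P2"
  then obtain A B where "\<not> affine_dependent A" "P1 = convex hull A"
    "\<not> affine_dependent B" "P2 = convex hull B"
    unfolding is_simplex_def simplex_def by blast
  then show "simple_polytope (disj_ext P1 P2)"
    using simple_polytope_convex_hull_affine_independent[OF affine_independent_lifts]
      disj_ext_convex_hull[of A B] assms by auto
qed

end
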